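(* Let $C_{10}^{12},C_{01}^{12},C_{10}^{21},C_{20}^{21},C_{01}^{21},C_{11}^{21},C_{02}^{21}\in\mathbb{C}$ with $C_{02}^{21}\neq 0$, and let $\omega_{\lambda(2)}$ be the $1$-form attached to the partition $\lambda(2)=(3,2,1^2)$ of $7$ and the leading terms $LT_{21}=\{y^3,-yz^2,y^2z\}$, with local representation $f\,dy+g\,dz$ at $[1:0:0]$ given by $$f=-C_{10}^{12}y-y^{2}-C_{01}^{12}z+C_{20}^{21}yz+C_{11}^{21}z^{2}-yz^{2},$$ $$g=-C_{10}^{21}y-C_{20}^{21}y^{2}-C_{01}^{21}z-C_{11}^{21}yz+y^{2}z-C_{02}^{21}z^{2}.$$ Assume that the algebraic multiplicity satisfies $m_{[1:0:0]}(\omega_{\lambda(2)})=2$. Then $$4\le I_0(f,g)\le 6.$$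
   Context: The form is $\omega_{\lambda(2)}=A\,dx+B\,dy+C\,dz$ on $\mathbb{CP}^2$, where $A,B,C\in\mathbb{C}[x,y,z]$ are homogeneous of degree $3$ with $xA+yB+zC=0$; $B,C$ are the homogenizations of $f,g$ to degree $3$ with respect to $x$ (so $f=B(1,y,z)$, $g=C(1,y,z)$), and $A$ is determined by the Euler relation. The point $[1:0:0]$ is a zero of $A,B,C$. The algebraic multiplicity $m_{[1:0:0]}(\omega)$ is $\min\{m,s\}$, where $m$ (resp. $s$) is the lowest degree of a nonzero homogeneous component of $f$ (resp. $g$). $I_0(f,g)=\dim_{\mathbb{C}}\mathcal{O}_{\mathbb{C}^2,(0,0)}/\langle f,g\rangle$ is the intersection index of $f$ and $g$ at the origin ($\infty$ if the dimension is infinite). *)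

theory Defs
  imports
    "HOL-Algebra.Embedded_Algebras"
    "HOL-Algebra.QuotRing"
    "HOL-Analysis.Infinite_Sum"
    "HOL-Computational_Algebra.Computational_Algebra"
    "HOL-Library.Extended_Nat"
begin

hide_const (open) up_ring.coeff up_ring.monom Multiset.mult

section \<open>Polynomials in two and three variables\<close>

text \<open>
  \<open>\<complex>[y,z]\<close> is \<^typ>\<open>complex poly poly\<close>, the outer variable being \<open>z\<close> and the inner one \<open>y\<close>:
  the coefficient of \<open>y\<^sup>i z\<^sup>j\<close> in \<open>p\<close> is \<open>coeff (coeff p j) i\<close>.
  \<open>\<complex>[x,y,z]\<close> is \<^typ>\<open>complex poly poly poly\<close>, i.e. \<open>\<complex>[y,z][x]\<close>, so that
  \<open>poly P 1\<close> is the dehomogenization \<open>P(1,y,z)\<close>.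
\<close>

definition var_y :: "complex poly poly" where
  "var_y = [:[:0, 1:]:]"

definition var_z :: "complex poly poly" where
  "var_z = [:0, 1:]"

definition cst :: "complex \<Rightarrow> complex poly poly" where
  "cst c = [:[:c:]:]"

definition hom_component :: "nat \<Rightarrow> complex poly poly \<Rightarrow> complex poly poly" where
  "hom_component d p = (\<Sum>i\<le>d. monom (monom (coeff (coeff p (d - i)) i) i) (d - i))"

text \<open>Lowest degree of a nonzero homogeneous component; it is \<open>\<infinity>\<close> for the zero polynomial.\<close>

definition lowest_degree :: "complex poly poly \<Rightarrow> enat" where
  "lowest_degree p = (INF d \<in> {d. hom_component d p \<noteq> 0}. enat d)"

text \<open>Homogenization to degree \<open>d\<close> with respect to \<open>x\<close> (meant for \<open>p\<close> of total degree at most \<open>d\<close>).\<close>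

definition homogenize :: "nat \<Rightarrow> complex poly poly \<Rightarrow> complex poly poly poly" where
  "homogenize d p = (\<Sum>k\<le>d. monom (hom_component k p) (d - k))"

definition homogeneous :: "nat \<Rightarrow> complex poly poly poly \<Rightarrow> bool" where
  "homogeneous d P \<longleftrightarrow>
     (\<forall>i j k. coeff (coeff (coeff P k) j) i \<noteq> 0 \<longrightarrow> i + j + k = d)"

section \<open>One-forms on the projective plane\<close>

text \<open>The triple \<open>(A, B, C)\<close> stands for \<open>A dx + B dy + C dz\<close>.\<close>

type_synonym one_form =
  "complex poly poly poly \<times> complex poly poly poly \<times> complex poly poly poly"

text \<open>The last conjunct is the Euler relation \<open>x A + y B + z C = 0\<close>.\<close>

definition projective_one_form :: "nat \<Rightarrow> one_form \<Rightarrow> bool" where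
  "projective_one_form d \<omega> = (case \<omega> of (A, B, C) \<Rightarrow>
     homogeneous d A \<and> homogeneous d B \<and> homogeneous d C \<and>
     [:0, 1:] * A + [:var_y:] * B + [:var_z:] * C = 0)"

text \<open>In the chart \<open>x = 1\<close>, where \<open>dx = 0\<close>, the form is \<open>B(1,y,z) dy + C(1,y,z) dz\<close>.\<close>

definition alg_multiplicity_100 :: "one_form \<Rightarrow> enat" where
  "alg_multiplicity_100 \<omega> = (case \<omega> of (A, B, C) \<Rightarrow>
     min (lowest_degree (poly B 1)) (lowest_degree (poly C 1)))"

section \<open>The local ring of the complex plane at the origin\<close>

text \<open>
  Germs at the origin of holomorphic functions of two variables are identified with their
  Taylor series, i.e. with the power series in \<open>y\<close>, \<open>z\<close> that converge absolutely on some
  polydisc around the origin.  The coefficient of \<open>y\<^sup>i z\<^sup>j\<close> in \<open>F\<close> is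
  \<open>fps_nth (fps_nth F j) i\<close>.
\<close>

definition convergent_series :: "complex fps fps set" where
  "convergent_series = {F. \<exists>r::real. r > 0 \<and>
     (\<lambda>(i, j). norm (fps_nth (fps_nth F j) i) * r ^ (i + j)) summable_on (UNIV :: (nat \<times> nat) set)}"

definition local_ring :: "complex fps fps ring" where
  "local_ring = \<lparr>carrier = convergent_series, mult = (*), one = 1, zero = 0, add = (+)\<rparr>"

definition germ :: "complex poly poly \<Rightarrow> complex fps fps" where
  "germ p = fps_of_poly (map_poly fps_of_poly p)"

definition intersection_ideal :: "complex poly poly \<Rightarrow> complex poly poly \<Rightarrow> complex fps fps set" where
  "intersection_ideal f g = genideal local_ring {germ f, germ g}"

definition intersection_algebra ::
  "complex poly poly \<Rightarrow> complex poly poly \<Rightarrow> complex fps fps set ring" where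
  "intersection_algebra f g = local_ring Quot (intersection_ideal f g)"

text \<open>The scalars \<open>\<complex>\<close>, as the set of classes of the constant germs.\<close>

definition intersection_scalars ::
  "complex poly poly \<Rightarrow> complex poly poly \<Rightarrow> complex fps fps set set" where
  "intersection_scalars f g =
     range (\<lambda>c. intersection_ideal f g +>\<^bsub>local_ring\<^esub> germ (cst c))"

definition intersection_index :: "complex poly poly \<Rightarrow> complex poly poly \<Rightarrow> enat" where
  "intersection_index f g =
     (let Q = intersection_algebra f g; K = intersection_scalars f g in
      if ring.finite_dimension Q K (carrier Q) then enat (ring.dim Q K (carrier Q)) else \<infinity>)"

section \<open>The local ring is a commutative ring\<close>

lemma convergent_seriesI:
  assumes "r > 0" and bound: "\<And>i j. norm (fps_nth (fps_nth F j) i) * r ^ (i + j) \<le> M"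
  shows "F \<in> convergent_series"
proof -
  have g: "(\<lambda>n. (1/2::real) ^ n) summable_on (UNIV::nat set)"
    by (rule norm_summable_imp_summable_on) (simp add: norm_power)
  have "(\<lambda>(i::nat, j::nat). (1/2::real) ^ i * (1/2) ^ j) summable_on (UNIV \<times> UNIV)"
  proof (rule summable_on_SigmaI[where g = "\<lambda>i. (1/2::real) ^ i * infsum (\<lambda>n. (1/2) ^ n) UNIV"])
    show "((\<lambda>y. (case (x, y) of (i::nat, j::nat) \<Rightarrow> (1/2::real) ^ i * (1/2) ^ j))
        has_sum (1/2) ^ x * infsum (\<lambda>n. (1/2) ^ n) UNIV) UNIV" for x
      using has_sum_cmult_right[OF has_sum_infsum[OF g], of "(1/2) ^ x"] by simp
  qed (use summable_on_cmult_left[OF g] in auto)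
  from summable_on_cmult_right[OF this, of M]
  have s: "(\<lambda>(i::nat, j::nat). M * ((1/2::real) ^ i * (1/2) ^ j)) summable_on UNIV"
    by (simp add: case_prod_unfold)
  have "(\<lambda>(i, j). norm (fps_nth (fps_nth F j) i) * (r/2) ^ (i + j)) summable_on UNIV"
  proof (rule summable_on_comparison_test[OF s], safe)
    fix i j :: nat
    have "norm (fps_nth (fps_nth F j) i) * (r/2) ^ (i + j)
        = (norm (fps_nth (fps_nth F j) i) * r ^ (i + j)) * ((1/2) ^ i * (1/2) ^ j)"
      by (simp add: power_add power_divide field_simps)
    also have "\<dots> \<le> M * ((1/2) ^ i * (1/2) ^ j)"
      by (rule mult_right_mono[OF bound]) simp
    finally show "norm (fps_nth (fps_nth F j) i) * (r/2) ^ (i + j) \<le> M * ((1/2) ^ i * (1/2) ^ j)" .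
  qed (use assms(1) in auto)
  then show ?thesis
    unfolding convergent_series_def using assms(1) by (intro CollectI exI[of _ "r/2"]) simp
qed

lemma convergent_seriesE:
  assumes "F \<in> convergent_series"
  obtains r M where "r > 0" "M \<ge> 0"
    "\<And>\<rho> i j. 0 < \<rho> \<Longrightarrow> \<rho> \<le> r \<Longrightarrow> norm (fps_nth (fps_nth F j) i) * \<rho> ^ (i + j) \<le> M"
proof -
  obtain r :: real where r: "r > 0" and
    s: "(\<lambda>(i, j). norm (fps_nth (fps_nth F j) i) * r ^ (i + j)) summable_on UNIV"
    using assms unfolding convergent_series_def by blast
  define M where "M = infsum (\<lambda>(i, j). norm (fps_nth (fps_nth F j) i) * r ^ (i + j)) UNIV"
  have b: "norm (fps_nth (fps_nth F j) i) * r ^ (i + j) \<le> M" for i j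
    unfolding M_def using finite_sum_le_infsum[OF s, of "{(i, j)}"] r by auto
  have "norm (fps_nth (fps_nth F j) i) * \<rho> ^ (i + j) \<le> M" if "0 < \<rho>" "\<rho> \<le> r" for \<rho> i j
    using b[of j i] mult_left_mono[OF power_mono[of \<rho> r "i + j"], of "norm (fps_nth (fps_nth F j) i)"] that
    by auto
  moreover have "M \<ge> 0" using b[of 0 0] by (simp add: order_trans[OF norm_ge_zero])
  ultimately show ?thesis using that r by blast
qed

lemma convergent_series_add:
  assumes "F \<in> convergent_series" "G \<in> convergent_series"
  shows "F + G \<in> convergent_series"
proof -
  obtain r M where F: "r > 0" "M \<ge> 0"
    "\<And>\<rho> i j. 0 < \<rho> \<Longrightarrow> \<rho> \<le> r \<Longrightarrow> norm (fps_nth (fps_nth F j) i) * \<rho> ^ (i + j) \<le> M"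
    using assms(1) by (rule convergent_seriesE) blast
  obtain s N where G: "s > 0" "N \<ge> 0"
    "\<And>\<rho> i j. 0 < \<rho> \<Longrightarrow> \<rho> \<le> s \<Longrightarrow> norm (fps_nth (fps_nth G j) i) * \<rho> ^ (i + j) \<le> N"
    using assms(2) by (rule convergent_seriesE) blast
  show ?thesis
  proof (rule convergent_seriesI[of "min r s" _ "M + N"])
    fix i j
    have "norm (fps_nth (fps_nth (F + G) j) i) * min r s ^ (i + j)
      \<le> (norm (fps_nth (fps_nth F j) i) + norm (fps_nth (fps_nth G j) i)) * min r s ^ (i + j)"
      using F(1) G(1) by (intro mult_right_mono) (auto intro: norm_triangle_ineq)
    then show "norm (fps_nth (fps_nth (F + G) j) i) * min r s ^ (i + j) \<le> M + N"
      using F(3)[of "min r s" j i] G(3)[of "min r s" j i] F(1) G(1) by (simp add: distrib_right)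
  qed (use F G in auto)
qed

lemma convergent_series_uminus:
  assumes "F \<in> convergent_series"
  shows "- F \<in> convergent_series"
  using assms unfolding convergent_series_def by simp

lemma convergent_series_mult:
  assumes "F \<in> convergent_series" "G \<in> convergent_series"
  shows "F * G \<in> convergent_series"
proof -
  obtain r M where F: "r > 0" "M \<ge> 0"
    "\<And>\<rho> i j. 0 < \<rho> \<Longrightarrow> \<rho> \<le> r \<Longrightarrow> norm (fps_nth (fps_nth F j) i) * \<rho> ^ (i + j) \<le> M"
    using assms(1) by (rule convergent_seriesE) blast
  obtain s N where G: "s > 0" "N \<ge> 0"
    "\<And>\<rho> i j. 0 < \<rho> \<Longrightarrow> \<rho> \<le> s \<Longrightarrow> norm (fps_nth (fps_nth G j) i) * \<rho> ^ (i + j) \<le> N"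
    using assms(2) by (rule convergent_seriesE) blast
  define \<rho> where "\<rho> = min r s"
  have \<rho>: "\<rho> > 0" "\<rho> \<le> r" "\<rho> \<le> s" using F G by (auto simp: \<rho>_def)
  have pow: "real n + 1 \<le> 2 ^ n" for n
    by (induction n) auto
  show ?thesis
  proof (rule convergent_seriesI[of "\<rho>/2" _ "M * N"])
    fix i j
    have eq: "fps_nth (fps_nth (F * G) j) i =
       (\<Sum>k=0..j. \<Sum>l=0..i. fps_nth (fps_nth F k) l * fps_nth (fps_nth G (j - k)) (i - l))"
      by (simp add: fps_mult_nth fps_sum_nth)
    have "norm (fps_nth (fps_nth (F * G) j) i) * \<rho> ^ (i + j)
      \<le> (\<Sum>k=0..j. \<Sum>l=0..i. norm (fps_nth (fps_nth F k) l * fps_nth (fps_nth G (j - k)) (i - l))) * \<rho> ^ (i + j)"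
      unfolding eq using \<rho>(1)
      by (intro mult_right_mono order_trans[OF norm_sum] sum_mono order_refl) auto
    also have "\<dots> = (\<Sum>k=0..j. \<Sum>l=0..i. (norm (fps_nth (fps_nth F k) l) * \<rho> ^ (l + k)) *
         (norm (fps_nth (fps_nth G (j - k)) (i - l)) * \<rho> ^ ((i - l) + (j - k))))"
      unfolding sum_distrib_right
    proof (intro sum.cong refl)
      fix k l assume "k \<in> {0..j}" "l \<in> {0..i}"
      then have "i + j = (l + k) + ((i - l) + (j - k))" by auto
      then have "\<rho> ^ (i + j) = \<rho> ^ (l + k) * \<rho> ^ ((i - l) + (j - k))"
        by (metis power_add)
      then show "norm (fps_nth (fps_nth F k) l * fps_nth (fps_nth G (j - k)) (i - l)) * \<rho> ^ (i + j)
        = (norm (fps_nth (fps_nth F k) l) * \<rho> ^ (l + k)) *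
         (norm (fps_nth (fps_nth G (j - k)) (i - l)) * \<rho> ^ ((i - l) + (j - k)))"
        by (simp add: norm_mult)
    qed
    also have "\<dots> \<le> (\<Sum>k=0..j. \<Sum>l=0..i. M * N)"
      using \<rho> F(2) G(2) by (intro sum_mono mult_mono F(3) G(3)) auto
    also have "\<dots> = (real j + 1) * (real i + 1) * (M * N)"
      by (simp add: algebra_simps)
    also have "\<dots> \<le> 2 ^ j * 2 ^ i * (M * N)"
      using F(2) G(2) by (intro mult_right_mono mult_mono pow) auto
    finally have "norm (fps_nth (fps_nth (F * G) j) i) * \<rho> ^ (i + j) \<le> 2 ^ (i + j) * (M * N)"
      by (simp add: power_add mult_ac)
    then show "norm (fps_nth (fps_nth (F * G) j) i) * (\<rho>/2) ^ (i + j) \<le> M * N"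
      by (simp add: power_divide field_simps)
  qed (use \<rho> in auto)
qed

lemma germ_nth: "fps_nth (fps_nth (germ p) j) i = coeff (coeff p j) i"
  by (simp add: germ_def coeff_map_poly)

lemma germ_in_convergent_series: "germ p \<in> convergent_series"
proof -
  let ?h = "\<lambda>(i, j). norm (fps_nth (fps_nth (germ p) j) i) * 1 ^ (i + j)"
  have fin: "finite (SIGMA j:{..degree p}. {..degree (coeff p j)})" (is "finite ?S") by simp
  have "?h summable_on (\<lambda>(j, i). (i, j)) ` ?S"
    using fin by (intro summable_on_finite finite_imageI)
  then have "?h summable_on UNIV"
  proof (rule summable_on_cong_neutral[THEN iffD1, rotated -1])
    fix x :: "nat \<times> nat"
    assume "x \<in> UNIV - (\<lambda>(j, i). (i, j)) ` ?S"
    then obtain i j where x: "x = (i, j)" "(j, i) \<notin> ?S" by (cases x) force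
    then have "coeff (coeff p j) i = 0"
      by (cases "j \<le> degree p") (auto simp: coeff_eq_0)
    then show "?h x = 0" by (simp add: x germ_nth)
  qed auto
  then show ?thesis unfolding convergent_series_def by (intro CollectI exI[of _ 1]) auto
qed

lemma cring_local_ring: "cring local_ring"
proof -
  have z: "0 \<in> convergent_series"
    using germ_in_convergent_series[of 0] by (simp add: germ_def)
  have o: "1 \<in> convergent_series"
    using germ_in_convergent_series[of 1] by (simp add: germ_def)
  show ?thesis
  proof (rule cringI)
    show "abelian_group local_ring"
    proof (rule abelian_groupI)
      fix F assume "F \<in> carrier local_ring"
      then show "\<exists>G\<in>carrier local_ring. G \<oplus>\<^bsub>local_ring\<^esub> F = \<zero>\<^bsub>local_ring\<^esub>"
        by (intro bexI[of _ "- F"]) (auto simp: local_ring_def convergent_series_uminus)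
    qed (auto simp: local_ring_def z convergent_series_add algebra_simps)
    show "Group.comm_monoid local_ring"
      by (rule comm_monoidI) (auto simp: local_ring_def o convergent_series_mult algebra_simps)
  qed (auto simp: local_ring_def algebra_simps)
qed

end

theory Submission
  imports Defs
begin

text \<open>
  Multiplicity two kills the linear terms.  With \<open>a, b, c\<close> for the coefficients
  \<open>C\<^sub>2\<^sub>0, C\<^sub>1\<^sub>1, C\<^sub>0\<^sub>2\<close> of index \<open>21\<close>, the equation \<open>f = 0\<close> is monic quadratic in \<open>y\<close>, so modulo \<open>f\<close>
  both \<open>g\<close> and \<open>y g\<close> are linear in \<open>y\<close> over \<open>\<complex>[z]\<close>.  The determinant of these two linear forms is
  \<open>z\<^sup>4 T\<close> with \<open>T = c\<^sup>2 - b\<^sup>3 - 3bc(z - a) - c(z - a)\<^sup>3\<close>, and \<open>T\<close> vanishes to order at most two at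
  \<open>z = 0\<close>.  Distinguishing cases by whether \<open>a\<^sup>2 + b\<close> and \<open>c - a\<^sup>3\<close> vanish, \<open>z\<^sup>4\<close> lies in the ideal and
  \<open>y z\<^sup>2\<close> is a multiple of \<open>z\<^sup>3\<close> modulo it; hence \<open>1, y, z, yz, z\<^sup>2, z\<^sup>3\<close> span the quotient.  For the lower bound,
  an element of the ideal has order at least two and its quadratic part is a combination of those
  of \<open>f\<close> and \<open>g\<close>, so some quadratic monomial is independent of \<open>1, y, z\<close>.
\<close>

section \<open>Spanning and independent families in quotient algebras\<close>

text \<open>Working from the end of the list, a vector is kept only if it lies outside the span of
  those after it. Dropping the others leaves the span unchanged, so generators thin out to a
  base.\<close>

lemma (in ring) exists_base_length_le:
  assumes K: "subfield K R" and "set Us \<subseteq> carrier R"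
  shows "\<exists>Vs. independent K Vs \<and> Span K Vs = Span K Us \<and> length Vs \<le> length Us"
  using assms(2)
proof (induction Us)
  case Nil
  then show ?case by (intro exI[of _ "[]"]) simp
next
  case (Cons u Us)
  then obtain Vs where Vs: "independent K Vs" "Span K Vs = Span K Us" "length Vs \<le> length Us"
    by auto
  have carr: "set Us \<subseteq> carrier R" "u \<in> carrier R" using Cons.prems by auto
  show ?case
  proof (cases "u \<in> Span K Us")
    case True
    then have "set (u # Us) \<subseteq> Span K Us"
      using Span_base_incl[OF K carr(1)] by simp
    then have "Span K (u # Us) = Span K Us"
      using mono_Span_subset[OF K _ carr(1)] mono_Span[OF K carr] by blast
    then show ?thesis using Vs by (intro exI[of _ Vs]) simp
  next
    case False
    then have "independent K (u # Vs)" using Vs carr by (intro li_Cons) auto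
    moreover have "Span K (u # Vs) = Span K (u # Us)" using Vs(2) by simp
    ultimately show ?thesis using Vs(3) by (intro exI[of _ "u # Vs"]) simp
  qed
qed

context ring_hom_ring
begin

text \<open>Spans commute with ring homomorphisms, so \<open>map h Us\<close> spans \<open>S\<close>
  and can be thinned to a base. The spanning hypothesis is stated upstairs, where it only concerns
  representatives modulo the kernel.\<close>

lemma image_dimension_le:
  assumes k: "subfield k R" and one: "\<one>\<^bsub>S\<^esub> \<noteq> \<zero>\<^bsub>S\<^esub>"
    and surj: "h ` carrier R = carrier S"
    and Us: "set Us \<subseteq> carrier R"
    and spans: "\<And>x. x \<in> carrier R \<Longrightarrow> \<exists>Ks. set Ks \<subseteq> k \<and> h x = h (R.combine Ks Us)"
  shows "\<exists>n\<le>length Us. dimension n (h ` k) (carrier S)"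
proof -
  have kc: "k \<subseteq> carrier R" by (rule subfieldE(3)[OF k])
  have sub: "set (map h Us) \<subseteq> carrier S"
    using Us by auto
  have "Span (h ` k) (map h Us) = h ` R.Span k Us"
    by (rule Span_hom[OF kc Us])
  also have "\<dots> = h ` carrier R"
  proof
    show "h ` R.Span k Us \<subseteq> h ` carrier R"
      using R.Span_in_carrier[OF kc Us] by auto
    show "h ` carrier R \<subseteq> h ` R.Span k Us"
    proof safe
      fix x assume "x \<in> carrier R"
      then obtain Ks where Ks: "set Ks \<subseteq> k" "h x = h (R.combine Ks Us)"
        using spans by blast
      moreover have "R.combine Ks Us \<in> R.Span k Us"
        using Ks(1) R.Span_eq_combine_set[OF k Us] by blast
      ultimately show "h x \<in> h ` R.Span k Us" by blast
    qed
  qed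
  finally have span: "Span (h ` k) (map h Us) = carrier S" using surj by simp
  obtain Vs where "independent (h ` k) Vs" "Span (h ` k) Vs = carrier S" "length Vs \<le> length Us"
    using exists_base_length_le[OF img_is_subfield(2)[OF k one] sub] span by auto
  then show ?thesis
    using dimension_independent by metis
qed

lemma image_dimension_ge:
  assumes k: "subfield k R" and one: "\<one>\<^bsub>S\<^esub> \<noteq> \<zero>\<^bsub>S\<^esub>"
    and Us: "set Us \<subseteq> carrier R"
    and indep: "\<And>Ks. set Ks \<subseteq> k \<Longrightarrow> length Ks = length Us \<Longrightarrow>
      h (R.combine Ks Us) = \<zero>\<^bsub>S\<^esub> \<Longrightarrow> set Ks \<subseteq> {\<zero>}"
    and dim: "dimension n (h ` k) (carrier S)"
  shows "length Us \<le> n"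
proof -
  note sf = img_is_subfield(2)[OF k one]
  have kc: "k \<subseteq> carrier R" by (rule subfieldE(3)[OF k])
  have sub: "set (map h Us) \<subseteq> carrier S"
    using Us by auto
  have "independent (h ` k) (map h Us)"
  proof (rule ccontr)
    assume dep: "dependent (h ` k) (map h Us)"
    obtain Ks where Ks: "length Ks = length Us" "combine Ks (map h Us) = \<zero>\<^bsub>S\<^esub>"
      "set Ks \<subseteq> h ` k" "set Ks \<noteq> {\<zero>\<^bsub>S\<^esub>}"
      using dependent_imp_non_trivial_combine[OF sf sub dep] by (metis length_map)
    obtain Ls where Ls: "set Ls \<subseteq> k" "Ks = map h Ls"
      using Ks(3) by (induct Ks) (auto, metis insert_subset list.simps(15,9))
    have "h (R.combine Ls Us) = \<zero>\<^bsub>S\<^esub>"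
      using combine_hom[of Ls Us] Ls kc Us Ks(2) by auto
    then have "set Ls \<subseteq> {\<zero>}" using indep Ls Ks(1) by simp
    then have "set Ks \<subseteq> {\<zero>\<^bsub>S\<^esub>}" using Ls(2) hom_zero by auto
    \<comment> \<open>Nontriviality is expressed as \<open>set Ks\<close> differing from the
      singleton of zero, which the empty list also satisfies; this leaves the empty family, which is
      independent.\<close>
    then have "Ks = []" using Ks(4) by (metis set_empty2 subset_singletonD)
    then have "Us = []" using Ks(1) by simp
    then show False using dep by simp
  qed
  from independent_length_le_dimension[OF sf dim this sub] show ?thesis by simp
qed

end

section \<open>Convergent power series\<close>

definition const_germ :: "complex \<Rightarrow> complex fps fps" where
  "const_germ c = fps_const (fps_const c)"

definition Y :: "complex fps fps" where
  "Y = fps_const fps_X"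

definition Z :: "complex fps fps" where
  "Z = fps_X"

text \<open>The exponent of \<open>Y\<close> comes first, opposite to the nesting of the series,
  whose outer variable is \<open>Z\<close>.\<close>

definition coeff2 :: "nat \<Rightarrow> nat \<Rightarrow> complex fps fps \<Rightarrow> complex" where
  "coeff2 i j F = fps_nth (fps_nth F j) i"

lemma fps2_eqI: "(\<And>i j. coeff2 i j F = coeff2 i j G) \<Longrightarrow> F = G"
  by (intro fps_ext) (auto simp: coeff2_def)

lemma coeff2_add [simp]: "coeff2 i j (F + G) = coeff2 i j F + coeff2 i j G"
  and coeff2_diff [simp]: "coeff2 i j (F - G) = coeff2 i j F - coeff2 i j G"
  and coeff2_uminus [simp]: "coeff2 i j (- F) = - coeff2 i j F"
  and coeff2_zero [simp]: "coeff2 i j 0 = 0"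
  and coeff2_one: "coeff2 i j 1 = (if i = 0 \<and> j = 0 then 1 else 0)"
  and coeff2_germ: "coeff2 i j (germ p) = coeff (coeff p j) i"
  by (auto simp: coeff2_def germ_nth)

lemma coeff2_const_mult [simp]: "coeff2 i j (const_germ c * F) = c * coeff2 i j F"
  by (simp add: coeff2_def const_germ_def)

lemma coeff2_Y_mult [simp]: "coeff2 i j (Y * F) = (if i = 0 then 0 else coeff2 (i - 1) j F)"
  by (simp add: coeff2_def Y_def)

lemma coeff2_Z_mult [simp]: "coeff2 i j (Z * F) = (if j = 0 then 0 else coeff2 i (j - 1) F)"
  by (simp add: coeff2_def Z_def)

lemma coeff2_const: "coeff2 i j (const_germ c) = (if i = 0 \<and> j = 0 then c else 0)"
  by (auto simp: coeff2_def const_germ_def)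

lemma coeff2_Y: "coeff2 i j Y = (if i = 1 \<and> j = 0 then 1 else 0)"
  by (auto simp: coeff2_def Y_def fps_X_nth)

lemma coeff2_Z: "coeff2 i j Z = (if i = 0 \<and> j = 1 then 1 else 0)"
  by (auto simp: coeff2_def Z_def fps_X_nth)

lemma coeff2_mult:
  "coeff2 i j (F * G) = (\<Sum>(k, l)\<in>{0..j} \<times> {0..i}. coeff2 l k F * coeff2 (i - l) (j - k) G)"
  by (simp add: coeff2_def fps_mult_nth fps_sum_nth sum.cartesian_product)

lemma coeff2_0_mult: "coeff2 0 0 (F * G) = coeff2 0 0 F * coeff2 0 0 G"
  by (simp add: coeff2_mult)

text \<open>In the convolution, every term except the one with the constant term of \<open>F\<close>
  uses a coefficient of \<open>G\<close> of total degree below \<open>i + j\<close>.\<close>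

lemma coeff2_mult_lowest:
  assumes "\<And>k l. k + l < i + j \<Longrightarrow> coeff2 k l G = 0"
  shows "coeff2 i j (F * G) = coeff2 0 0 F * coeff2 i j G"
proof -
  have "coeff2 i j (F * G) = (\<Sum>(k, l)\<in>{(0, 0)}. coeff2 l k F * coeff2 (i - l) (j - k) G)"
    unfolding coeff2_mult
  proof (rule sum.mono_neutral_right, goal_cases)
    case 3
    then show ?case by (auto intro!: assms)
  qed auto
  then show ?thesis by simp
qed

lemma const_germ_hom:
  "const_germ (c + d) = const_germ c + const_germ d"
  "const_germ (c - d) = const_germ c - const_germ d"
  "const_germ (- c) = - const_germ c"
  "const_germ (c * d) = const_germ c * const_germ d"
  "const_germ (c ^ n) = const_germ c ^ n"
  "const_germ 0 = 0" "const_germ 1 = 1" "const_germ (numeral m) = numeral m"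
  by (simp_all add: const_germ_def fps_const_power[symmetric] numeral_fps_const del: fps_const_power)

lemma coeff2_0_numeral: "coeff2 0 0 (numeral m) = numeral m"
  using coeff2_const[of 0 0 "numeral m"] by (simp add: const_germ_hom)

lemma germ_hom:
  "germ (p + q) = germ p + germ q"
  "germ (p - q) = germ p - germ q"
  "germ (- p) = - germ p"
  "germ (p * q) = germ p * germ q"
  "germ 1 = 1"
  "germ (p ^ n) = germ p ^ n"
proof -
  show mult: "germ (p * q) = germ p * germ q" for p q
    by (intro fps_ext) (simp add: germ_nth fps_mult_nth fps_sum_nth coeff_mult coeff_sum atLeast0AtMost)
  show one: "germ 1 = 1" by (simp add: germ_def)
  show "germ (p ^ n) = germ p ^ n" by (induction n) (simp_all add: mult one)
qed (rule fps2_eqI; simp add: coeff2_germ)+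

lemma germ_cst: "germ (cst c) = const_germ c"
  and germ_var_y: "germ var_y = Y"
  and germ_var_z: "germ var_z = Z"
  by (simp_all add: germ_def cst_def var_y_def var_z_def const_germ_def Y_def Z_def map_poly_pCons
      fps_of_poly_pCons)

lemma convergent_const [simp]: "const_germ c \<in> convergent_series"
  and convergent_Y [simp]: "Y \<in> convergent_series"
  and convergent_Z [simp]: "Z \<in> convergent_series"
  by (metis germ_in_convergent_series germ_cst germ_var_y germ_var_z)+

lemma convergent_0 [simp]: "0 \<in> convergent_series" and convergent_1 [simp]: "1 \<in> convergent_series"
  using convergent_const[of 0] convergent_const[of 1] by (simp_all add: const_germ_hom)

lemma convergent_numeral [simp]: "numeral m \<in> convergent_series"
  using convergent_const[of "numeral m"] by (simp add: const_germ_hom)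

lemmas [simp] = convergent_series_add convergent_series_mult convergent_series_uminus

lemma convergent_diff [simp]:
  "F \<in> convergent_series \<Longrightarrow> G \<in> convergent_series \<Longrightarrow> F - G \<in> convergent_series"
  using convergent_series_add[of F "- G"] by simp

lemma convergent_power [simp]: "F \<in> convergent_series \<Longrightarrow> F ^ n \<in> convergent_series"
  by (induction n) auto

text \<open>Hadamard's lemma, the engine of the descent on monomials: \<open>H\<close> takes all
  terms divisible by \<open>Z\<close>, and \<open>G\<close> takes the pure powers of
  \<open>Y\<close>. Lowering an exponent by one costs a factor \<open>r\<close> in the coefficient
  bound, hence \<open>M / r\<close>.\<close>

lemma convergent_series_decompose:
  assumes "F \<in> convergent_series"
  obtains c G H where "G \<in> convergent_series" "H \<in> convergent_series" "F = const_germ c + Y * G + Z * H"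
proof -
  obtain r M where r: "r > 0" "M \<ge> 0"
    and b: "\<And>\<rho> i j. 0 < \<rho> \<Longrightarrow> \<rho> \<le> r \<Longrightarrow> norm (fps_nth (fps_nth F j) i) * \<rho> ^ (i + j) \<le> M"
    using assms by (rule convergent_seriesE) blast
  have b': "norm (fps_nth (fps_nth F j) i) * r ^ (i + j) \<le> M" for i j
    using b r(1) by simp
  define G where "G = fps_const (fps_shift 1 (fps_nth F 0))"
  define H where "H = fps_shift 1 F"
  have "G \<in> convergent_series"
  proof (rule convergent_seriesI[OF r(1), of _ "M / r"])
    fix i j
    show "norm (fps_nth (fps_nth G j) i) * r ^ (i + j) \<le> M / r"
      using b'[of 0 "Suc i"] r by (cases j) (auto simp: G_def field_simps)
  qed
  moreover have "H \<in> convergent_series"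
  proof (rule convergent_seriesI[OF r(1), of _ "M / r"])
    fix i j
    show "norm (fps_nth (fps_nth H j) i) * r ^ (i + j) \<le> M / r"
      using b'[of "Suc j" i] r by (auto simp: H_def field_simps)
  qed
  moreover have "F = const_germ (coeff2 0 0 F) + Y * G + Z * H"
  proof (rule fps2_eqI)
    fix i j
    show "coeff2 i j F = coeff2 i j (const_germ (coeff2 0 0 F) + Y * G + Z * H)"
      by (cases i; cases j) (simp_all add: coeff2_const, simp_all add: coeff2_def G_def H_def)
  qed
  ultimately show ?thesis using that by blast
qed

text \<open>A formal inverse exists, and only its convergence needs work. On a small enough polydisc
  the nonconstant terms of \<open>F\<close> have absolute sum at most the norm of the constant term,
  so the recursion for the inverse preserves one uniform bound.\<close>

lemma convergent_series_unit:
  assumes F: "F \<in> convergent_series" and F0: "coeff2 0 0 F \<noteq> 0"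
  obtains G where "G \<in> convergent_series" "F * G = 1"
proof -
  define e where "e = coeff2 0 0 F"
  have e: "norm e > 0" using F0 by (simp add: e_def)
  \<comment> \<open>As a series in \<open>Z\<close> over the series in \<open>Y\<close>,
    \<open>F\<close> is invertible once its \<open>Z\<close>-constant term is, and that term is a
    unit because \<open>e\<close> is nonzero.\<close>
  have "fps_nth F 0 * inverse (fps_nth F 0) = 1"
    using F0 by (intro inverse_mult_eq_1') (simp add: coeff2_def)
  from fps_right_inverse[OF this] obtain G where G: "F * G = 1" by blast
  obtain r :: real where r: "r > 0" and
    s: "(\<lambda>(i, j). norm (coeff2 i j F) * r ^ (i + j)) summable_on UNIV"
    using F unfolding convergent_series_def coeff2_def by blast
  define M where "M = infsum (\<lambda>(i, j). norm (coeff2 i j F) * r ^ (i + j)) UNIV"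
  have bM: "(\<Sum>(i, j)\<in>A. norm (coeff2 i j F) * r ^ (i + j)) \<le> M" if "finite A" for A
    unfolding M_def using r that by (intro finite_sum_le_infsum[OF s]) auto
  have M0: "M \<ge> 0" using bM[of "{}"] by simp
  \<comment> \<open>The cap \<open>1\<close> gives \<open>q ^ n \<le> q\<close> for positive
    \<open>n\<close>, the quotient gives \<open>q * M \<le> norm e\<close>, and \<open>M + 1\<close>
    keeps the denominator positive.\<close>
  define q where "q = min 1 (norm e / (M + 1))"
  have q: "0 < q" "q \<le> 1" using e M0 by (auto simp: q_def)
  have "q * M \<le> norm e / (M + 1) * (M + 1)"
    using M0 e q by (intro mult_mono) (auto simp: q_def)
  then have qM: "q * M \<le> norm e" using M0 by simp
  define t where "t = q * r"
  have t: "t > 0" using q r by (simp add: t_def)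
  \<comment> \<open>Shrinking the radius from \<open>r\<close> to \<open>q * r\<close> gains at
    least one factor \<open>q\<close> on every nonconstant term.\<close>
  have bF: "norm (coeff2 l k F) * t ^ (l + k) \<le> q * (norm (coeff2 l k F) * r ^ (l + k))"
    if kl: "(k, l) \<noteq> (0, 0)" for k l
  proof -
    obtain m where "l + k = Suc m" using kl by (cases "l + k") auto
    then have "q ^ (l + k) \<le> q" using q by (simp add: mult_left_le power_le_one)
    then have "q ^ (l + k) * (norm (coeff2 l k F) * r ^ (l + k)) \<le> q * (norm (coeff2 l k F) * r ^ (l + k))"
      using r by (intro mult_right_mono) auto
    then show ?thesis by (simp add: t_def power_mult_distrib mult_ac)
  qed
  \<comment> \<open>Induction on total degree: comparing coefficients in \<open>F * G = 1\<close>
    expresses \<open>e * coeff2 i j G\<close> through coefficients of \<open>G\<close> of smaller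
    degree.\<close>
  have bG: "norm (coeff2 i j G) * t ^ (i + j) \<le> 1 / norm e" for i j
  proof (induction "i + j" arbitrary: i j rule: less_induct)
    case less
    show ?case
    proof (cases "i = 0 \<and> j = 0")
      case True
      have "e * coeff2 0 0 G = 1"
        using coeff2_0_mult[of F G] G by (simp add: e_def coeff2_one)
      then have "norm e * norm (coeff2 0 0 G) = 1" by (metis norm_mult norm_one)
      then show ?thesis using True e by (simp add: field_simps)
    next
      case False
      define B where "B = {0..j} \<times> {0..i} - {(0::nat, 0::nat)}"
      have finB: "finite B" by (simp add: B_def)
      have "0 = coeff2 i j (F * G)" using G False by (auto simp: coeff2_one)
      also have "\<dots> = e * coeff2 i j G + (\<Sum>(k, l)\<in>B. coeff2 l k F * coeff2 (i - l) (j - k) G)"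
        unfolding coeff2_mult B_def by (subst sum.remove[of _ "(0, 0)"]) (auto simp: e_def)
      finally have "e * coeff2 i j G = - (\<Sum>(k, l)\<in>B. coeff2 l k F * coeff2 (i - l) (j - k) G)"
        by (rule iffD2[OF eq_neg_iff_add_eq_0 sym])
      from arg_cong[OF this, of norm]
      have "norm e * norm (coeff2 i j G) = norm (\<Sum>(k, l)\<in>B. coeff2 l k F * coeff2 (i - l) (j - k) G)"
        unfolding norm_mult norm_minus_cancel .
      then have "norm e * (norm (coeff2 i j G) * t ^ (i + j))
          = norm (\<Sum>(k, l)\<in>B. coeff2 l k F * coeff2 (i - l) (j - k) G) * t ^ (i + j)"
        by simp
      also have "\<dots> \<le> (\<Sum>x\<in>B. norm (case x of (k, l) \<Rightarrow> coeff2 l k F * coeff2 (i - l) (j - k) G)) * t ^ (i + j)"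
        using t by (intro mult_right_mono norm_sum) auto
      also have "\<dots> \<le> (\<Sum>(k, l)\<in>B. q * (norm (coeff2 l k F) * r ^ (l + k)) * (1 / norm e))"
        unfolding sum_distrib_right
      proof (rule sum_mono, clarify)
        fix k l assume kl: "(k, l) \<in> B"
        then have "i + j = (l + k) + ((i - l) + (j - k))" by (auto simp: B_def)
        then have "t ^ (i + j) = t ^ (l + k) * t ^ ((i - l) + (j - k))" by (metis power_add)
        then have "norm (coeff2 l k F * coeff2 (i - l) (j - k) G) * t ^ (i + j)
          = (norm (coeff2 l k F) * t ^ (l + k)) * (norm (coeff2 (i - l) (j - k) G) * t ^ ((i - l) + (j - k)))"
          by (simp add: norm_mult)
        also have "\<dots> \<le> q * (norm (coeff2 l k F) * r ^ (l + k)) * (1 / norm e)"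
          using kl t q r by (intro mult_mono bF less.hyps) (auto simp: B_def)
        finally show "norm (coeff2 l k F * coeff2 (i - l) (j - k) G) * t ^ (i + j)
          \<le> q * (norm (coeff2 l k F) * r ^ (l + k)) * (1 / norm e)" .
      qed
      also have "\<dots> = q * (\<Sum>(k, l)\<in>B. norm (coeff2 l k F) * r ^ (l + k)) * (1 / norm e)"
        by (simp add: sum_distrib_left sum_divide_distrib case_prod_unfold)
      \<comment> \<open>The product formula lists the \<open>Z\<close>-exponent first and the bound
        by \<open>M\<close> the \<open>Y\<close>-exponent, hence the swap.\<close>
      also have "(\<Sum>(k, l)\<in>B. norm (coeff2 l k F) * r ^ (l + k))
          = (\<Sum>(l, k)\<in>prod.swap ` B. norm (coeff2 l k F) * r ^ (l + k))"
        by (subst sum.reindex) (auto simp: case_prod_unfold)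
      also have "q * (\<Sum>(l, k)\<in>prod.swap ` B. norm (coeff2 l k F) * r ^ (l + k)) * (1 / norm e)
          \<le> q * M * (1 / norm e)"
        using q finB e by (intro mult_right_mono mult_left_mono bM) auto
      also have "\<dots> \<le> norm e * (1 / norm e)"
        using qM e by (intro mult_right_mono) auto
      finally show ?thesis using e by (subst (asm) mult_le_cancel_left_pos) auto
    qed
  qed
  have "G \<in> convergent_series"
    using bG t by (intro convergent_seriesI[of t]) (auto simp: coeff2_def)
  then show ?thesis using G that by blast
qed

section \<open>The intersection algebra\<close>

lemma carrier_local_ring [simp]: "carrier local_ring = convergent_series"
  and mult_local_ring [simp]: "x \<otimes>\<^bsub>local_ring\<^esub> y = x * y"
  and add_local_ring [simp]: "x \<oplus>\<^bsub>local_ring\<^esub> y = x + y"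
  and one_local_ring [simp]: "\<one>\<^bsub>local_ring\<^esub> = 1"
  and zero_local_ring [simp]: "\<zero>\<^bsub>local_ring\<^esub> = 0"
  by (simp_all add: local_ring_def)

interpretation local_ring: cring local_ring
  by (rule cring_local_ring)

lemma uminus_local_ring [simp]:
  "x \<in> convergent_series \<Longrightarrow> \<ominus>\<^bsub>local_ring\<^esub> x = - x"
  by (rule local_ring.minus_equality) auto

lemma minus_local_ring [simp]:
  "y \<in> convergent_series \<Longrightarrow> x \<ominus>\<^bsub>local_ring\<^esub> y = x - y"
  by (simp add: a_minus_def)

text \<open>The scalars of the intersection algebra are the image of this field, so linear algebra
  can be done with constant germs as coefficients.\<close>

lemma subfield_constants: "subfield (range const_germ) local_ring"
proof (rule local_ring.subfieldI)
  show "subcring (range const_germ) local_ring"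
  proof (rule local_ring.subcringI', rule local_ring.subringI)
    fix x y assume "x \<in> range const_germ" "y \<in> range const_germ"
    then obtain c d where "x = const_germ c" "y = const_germ d" by auto
    then show "x \<otimes>\<^bsub>local_ring\<^esub> y \<in> range const_germ" "x \<oplus>\<^bsub>local_ring\<^esub> y \<in> range const_germ"
      by (auto simp flip: const_germ_hom)
  next
    fix x assume "x \<in> range const_germ"
    then show "\<ominus>\<^bsub>local_ring\<^esub> x \<in> range const_germ"
      by (auto simp flip: const_germ_hom)
  next
    show "\<one>\<^bsub>local_ring\<^esub> \<in> range const_germ"
      using const_germ_hom(7) by (metis one_local_ring rangeI)
  qed auto
  show "Units (local_ring\<lparr>carrier := range const_germ\<rparr>) = range const_germ - {\<zero>\<^bsub>local_ring\<^esub>}"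
  proof
    show "Units (local_ring\<lparr>carrier := range const_germ\<rparr>) \<subseteq> range const_germ - {\<zero>\<^bsub>local_ring\<^esub>}"
      by (auto simp: Units_def)
    show "range const_germ - {\<zero>\<^bsub>local_ring\<^esub>} \<subseteq> Units (local_ring\<lparr>carrier := range const_germ\<rparr>)"
    proof
      fix x assume "x \<in> range const_germ - {\<zero>\<^bsub>local_ring\<^esub>}"
      then obtain c where x: "x = const_germ c" and "const_germ c \<noteq> 0" by auto
      then have "c \<noteq> 0" by (auto simp: const_germ_hom)
      then have "const_germ (inverse c) * const_germ c = 1" "const_germ c * const_germ (inverse c) = 1"
        by (simp_all flip: const_germ_hom)
      then show "x \<in> Units (local_ring\<lparr>carrier := range const_germ\<rparr>)"
        by (auto simp: Units_def x)
    qed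
  qed
qed

section \<open>Membership in a fixed ideal of the local ring\<close>

locale germ_ideal =
  fixes I :: "complex fps fps set"
  assumes ideal: "ideal I local_ring"
begin

lemma add_mem: "x \<in> I \<Longrightarrow> y \<in> I \<Longrightarrow> x + y \<in> I"
  using additive_subgroup.a_closed[OF ideal.axioms(1)[OF ideal]] by force

lemma mult_mem: "x \<in> I \<Longrightarrow> r \<in> convergent_series \<Longrightarrow> r * x \<in> I"
  using ideal.I_l_closed[OF ideal] by force

lemma zero_mem: "0 \<in> I"
  using additive_subgroup.zero_closed[OF ideal.axioms(1)[OF ideal]] by simp

lemma diff_mem: "x \<in> I \<Longrightarrow> y \<in> I \<Longrightarrow> x - y \<in> I"
  using add_mem[of x "- y"] mult_mem[of y "-1"] by simp

text \<open>This is where localness enters: a germ with nonzero constant term is a unit and can be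
  cancelled.\<close>

lemma unit_mult_mem:
  assumes "u * x \<in> I" "coeff2 0 0 u \<noteq> 0" "u \<in> convergent_series"
  shows "x \<in> I"
proof -
  obtain v where "v \<in> convergent_series" "u * v = 1"
    using convergent_series_unit assms by blast
  then have "v * (u * x) \<in> I" "v * (u * x) = x"
    using mult_mem[OF assms(1)] by (auto simp: mult_ac) (metis mult.assoc mult.commute mult_1)
  then show ?thesis by simp
qed

text \<open>The relations put every monomial of degree four into \<open>I\<close>, so the quotient
  is spanned by monomials of degree at most three; \<open>f\<close> and the relation for
  \<open>Y * Z ^ 2\<close> reduce these to the six listed.\<close>

lemma spanned_by_six:
  assumes f: "Y ^ 2 - (const_germ a * Y * Z + const_germ b * Z ^ 2 - Y * Z ^ 2) \<in> I" (is "?f \<in> I")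
    and z4: "Z ^ 4 \<in> I" and yz2: "Y * Z ^ 2 - const_germ \<kappa> * Z ^ 3 \<in> I" (is "?h \<in> I")
    and F: "F \<in> convergent_series"
  shows "\<exists>c1 c2 c3 c4 c5 c6. F - (const_germ c1 + const_germ c2 * Y + const_germ c3 * Z
           + const_germ c4 * (Y * Z) + const_germ c5 * Z ^ 2 + const_germ c6 * Z ^ 3) \<in> I"
proof -
  define lc where "lc c1 c2 c3 c4 c5 c6 = const_germ c1 + const_germ c2 * Y + const_germ c3 * Z
    + const_germ c4 * (Y * Z) + const_germ c5 * Z ^ 2 + const_germ c6 * Z ^ 3" for c1 c2 c3 c4 c5 c6
  \<comment> \<open>\<open>S\<close> is the sum of \<open>I\<close> and the linear span of the six
    monomials; the goal is that it contains every convergent series.\<close>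
  define S where "S = {F. \<exists>c1 c2 c3 c4 c5 c6. F - lc c1 c2 c3 c4 c5 c6 \<in> I}"
  have S_lc: "lc c1 c2 c3 c4 c5 c6 \<in> S" for c1 c2 c3 c4 c5 c6
  proof -
    have "lc c1 c2 c3 c4 c5 c6 - lc c1 c2 c3 c4 c5 c6 \<in> I" using zero_mem by simp
    then show ?thesis unfolding S_def by blast
  qed
  have S_add: "G + H \<in> S" if GH: "G \<in> S" "H \<in> S" for G H
  proof -
    obtain c1 c2 c3 c4 c5 c6 d1 d2 d3 d4 d5 d6
      where "G - lc c1 c2 c3 c4 c5 c6 \<in> I" "H - lc d1 d2 d3 d4 d5 d6 \<in> I"
      using GH unfolding S_def by blast
    then have "(G - lc c1 c2 c3 c4 c5 c6) + (H - lc d1 d2 d3 d4 d5 d6) \<in> I" by (rule add_mem)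
    also have "(G - lc c1 c2 c3 c4 c5 c6) + (H - lc d1 d2 d3 d4 d5 d6)
      = (G + H) - lc (c1 + d1) (c2 + d2) (c3 + d3) (c4 + d4) (c5 + d5) (c6 + d6)"
      by (simp add: lc_def const_germ_hom algebra_simps)
    finally show ?thesis unfolding S_def by blast
  qed
  have S_const: "const_germ c * G \<in> S" if "G \<in> S" for c G
  proof -
    obtain c1 c2 c3 c4 c5 c6 where "G - lc c1 c2 c3 c4 c5 c6 \<in> I"
      using \<open>G \<in> S\<close> unfolding S_def by blast
    then have "const_germ c * (G - lc c1 c2 c3 c4 c5 c6) \<in> I" by (rule mult_mem) simp
    also have "const_germ c * (G - lc c1 c2 c3 c4 c5 c6)
      = const_germ c * G - lc (c * c1) (c * c2) (c * c3) (c * c4) (c * c5) (c * c6)"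
      by (simp add: lc_def const_germ_hom algebra_simps)
    finally show ?thesis unfolding S_def by blast
  qed
  have S_I: "G \<in> S" if "G \<in> I" for G
  proof -
    have "G - lc 0 0 0 0 0 0 \<in> I" using that by (simp add: lc_def const_germ_hom)
    then show ?thesis unfolding S_def by blast
  qed
  have S_I_add: "G \<in> S" if "G - H \<in> I" "H \<in> S" for G H
    using S_add[OF S_I[OF that(1)] that(2)] by simp

  \<comment> \<open>The degree-four monomials enter \<open>I\<close> one by one, from
    \<open>Z ^ 4\<close> to \<open>Y ^ 4\<close>, each obtained from the previous ones by trading a
    \<open>Z\<close> for a \<open>Y\<close>.\<close>
  have yz3: "Y * Z ^ 3 \<in> I"
  proof -
    have "Z * ?h + const_germ \<kappa> * Z ^ 4 \<in> I"
      by (intro add_mem mult_mem yz2 z4) auto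
    then show ?thesis by (simp add: algebra_simps eval_nat_numeral)
  qed
  have y2z2: "Y ^ 2 * Z ^ 2 \<in> I"
  proof -
    have "Z ^ 2 * ?f + (const_germ a - Z) * (Y * Z ^ 3) + const_germ b * Z ^ 4 \<in> I"
      by (intro add_mem mult_mem f z4 yz3) auto
    then show ?thesis by (simp add: algebra_simps eval_nat_numeral)
  qed
  have y3z: "Y ^ 3 * Z \<in> I"
  proof -
    have "Y * Z * ?f + (const_germ a - Z) * (Y ^ 2 * Z ^ 2) + const_germ b * (Y * Z ^ 3) \<in> I"
      by (intro add_mem mult_mem f yz3 y2z2) auto
    then show ?thesis by (simp add: algebra_simps eval_nat_numeral)
  qed
  have y4: "Y ^ 4 \<in> I"
  proof -
    have "Y ^ 2 * ?f + const_germ a * (Y ^ 3 * Z) + (const_germ b - Y) * (Y ^ 2 * Z ^ 2) \<in> I"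
      by (intro add_mem mult_mem f y3z y2z2) auto
    then show ?thesis by (simp add: algebra_simps eval_nat_numeral)
  qed

  have S1: "1 \<in> S" and Sy: "Y \<in> S" and Sz: "Z \<in> S" and Syz: "Y * Z \<in> S"
    and Sz2: "Z ^ 2 \<in> S" and Sz3: "Z ^ 3 \<in> S"
    using S_lc[of 1 0 0 0 0 0] S_lc[of 0 1 0 0 0 0] S_lc[of 0 0 1 0 0 0]
      S_lc[of 0 0 0 1 0 0] S_lc[of 0 0 0 0 1 0] S_lc[of 0 0 0 0 0 1]
    by (simp_all add: lc_def const_germ_hom)
  \<comment> \<open>The other monomials of degree two and three: \<open>Y * Z ^ 2\<close> reduces to
    \<open>\<kappa>\<close> times \<open>Z ^ 3\<close>, the rest reduce through multiples of
    \<open>f\<close> with any degree-four terms dropped.\<close>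
  have Syz2: "Y * Z ^ 2 \<in> S"
    using yz2 by (rule S_I_add) (intro S_const Sz3)
  have "Y ^ 2 - (const_germ a * (Y * Z) + const_germ b * Z ^ 2 + const_germ (- 1) * (Y * Z ^ 2)) \<in> I"
    using f by (simp add: const_germ_hom mult.assoc)
  then have Sy2: "Y ^ 2 \<in> S"
    by (rule S_I_add) (intro S_add S_const Syz Sz2 Syz2)
  have "Z * ?f - Y * Z ^ 3 \<in> I"
    by (intro diff_mem mult_mem f yz3) auto
  then have "Y ^ 2 * Z - (const_germ a * (Y * Z ^ 2) + const_germ b * Z ^ 3) \<in> I"
    by (simp add: algebra_simps eval_nat_numeral)
  then have Sy2z: "Y ^ 2 * Z \<in> S"
    by (rule S_I_add) (intro S_add S_const Syz2 Sz3)
  have "Y * ?f - Y ^ 2 * Z ^ 2 \<in> I"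
    by (intro diff_mem mult_mem f y2z2) auto
  then have "Y ^ 3 - (const_germ a * (Y ^ 2 * Z) + const_germ b * (Y * Z ^ 2)) \<in> I"
    by (simp add: algebra_simps eval_nat_numeral)
  then have Sy3: "Y ^ 3 \<in> S"
    by (rule S_I_add) (intro S_add S_const Syz2 Sy2z)

  \<comment> \<open>Splitting the multiplier turns multiples of \<open>m\<close> into a scalar
    multiple of \<open>m\<close> plus multiples of \<open>Y * m\<close> and \<open>Z * m\<close>,
    one degree higher.\<close>
  have step: "G * m \<in> S" if "m \<in> S" "G \<in> convergent_series"
    and Ym: "\<And>H. H \<in> convergent_series \<Longrightarrow> H * (Y * m) \<in> S"
    and Zm: "\<And>H. H \<in> convergent_series \<Longrightarrow> H * (Z * m) \<in> S" for m G
  proof -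
    obtain c H1 H2 where "H1 \<in> convergent_series" "H2 \<in> convergent_series"
      and G: "G = const_germ c + Y * H1 + Z * H2"
      using convergent_series_decompose[OF \<open>G \<in> convergent_series\<close>] .
    then have "const_germ c * m + H1 * (Y * m) + H2 * (Z * m) \<in> S"
      using \<open>m \<in> S\<close> by (intro S_add S_const Ym Zm) auto
    then show ?thesis by (simp add: G algebra_simps)
  qed
  have top: "G * m \<in> S" if "m \<in> I" "G \<in> convergent_series" for G m
    using that by (intro S_I mult_mem)
  note shape = algebra_simps eval_nat_numeral
  \<comment> \<open>Descent in degree from three to zero; the labels are the exponents of
    \<open>Y\<close> and \<open>Z\<close>. In degree three the next monomials already lie in
    \<open>I\<close>.\<close>
  have 30: "G * Y ^ 3 \<in> S" if "G \<in> convergent_series" for G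
    using that by (intro step[OF Sy3]) (use top[OF y4] top[OF y3z] in \<open>simp_all add: shape\<close>)
  have 21: "G * (Y ^ 2 * Z) \<in> S" if "G \<in> convergent_series" for G
    using that by (intro step[OF Sy2z]) (use top[OF y3z] top[OF y2z2] in \<open>simp_all add: shape\<close>)
  have 12: "G * (Y * Z ^ 2) \<in> S" if "G \<in> convergent_series" for G
    using that by (intro step[OF Syz2]) (use top[OF y2z2] top[OF yz3] in \<open>simp_all add: shape\<close>)
  have 03: "G * Z ^ 3 \<in> S" if "G \<in> convergent_series" for G
    using that by (intro step[OF Sz3]) (use top[OF yz3] top[OF z4] in \<open>simp_all add: shape\<close>)
  have 20: "G * Y ^ 2 \<in> S" if "G \<in> convergent_series" for G
    using that by (intro step[OF Sy2]) (use 30 21 in \<open>simp_all add: shape\<close>)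
  have 11: "G * (Y * Z) \<in> S" if "G \<in> convergent_series" for G
    using that by (intro step[OF Syz]) (use 21 12 in \<open>simp_all add: shape\<close>)
  have 02: "G * Z ^ 2 \<in> S" if "G \<in> convergent_series" for G
    using that by (intro step[OF Sz2]) (use 12 03 in \<open>simp_all add: shape\<close>)
  have 10: "G * Y \<in> S" if "G \<in> convergent_series" for G
    using that by (intro step[OF Sy]) (use 20 11 in \<open>simp_all add: shape\<close>)
  have 01: "G * Z \<in> S" if "G \<in> convergent_series" for G
    using that by (intro step[OF Sz]) (use 11 02 in \<open>simp_all add: shape\<close>)
  have "F * 1 \<in> S"
    by (intro step[OF S1 F]) (use 10 01 in \<open>simp_all add: shape\<close>)
  then show ?thesis by (simp add: S_def lc_def)
qed

text \<open>Eliminating \<open>Y\<close> between two elements linear in \<open>Y\<close> leaves a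
  power of \<open>Z\<close> times a germ in \<open>Z\<close>; cancelling units then isolates
  \<open>Z ^ 4\<close>. The constant \<open>\<kappa>\<close> is
  \<open>- (a * b + c) / (a ^ 2 + b)\<close>, \<open>0\<close> or \<open>a / 2\<close> in the three
  cases.\<close>

lemma standard_relations:
  fixes a b c :: complex
  assumes c: "c \<noteq> 0"
    and f: "- (Y ^ 2) + const_germ a * Y * Z + const_germ b * Z ^ 2 - Y * Z ^ 2 \<in> I" (is "?f \<in> I")
    and g: "- const_germ a * Y ^ 2 - const_germ b * Y * Z - const_germ c * Z ^ 2 + Y ^ 2 * Z \<in> I"
      (is "?g \<in> I")
  obtains \<kappa> where "Z ^ 4 \<in> I" "Y * Z ^ 2 - const_germ \<kappa> * Z ^ 3 \<in> I"
proof -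
  define A B C where "A = const_germ a" and "B = const_germ b" and "C = const_germ c"
  \<comment> \<open>\<open>w\<close> is the coefficient of \<open>Y ^ 2\<close> in \<open>g\<close>,
    and \<open>f\<close> equals \<open>- (Y ^ 2 + w * Y * Z - B * Z ^ 2)\<close>; hence adding
    \<open>w\<close> times \<open>f\<close> to \<open>g\<close> cancels
    \<open>Y ^ 2\<close>.\<close>
  define w where "w = Z - A"
  define U p V where "U = w ^ 2 + B" and "p = B * w - C" and "V = w ^ 3 + 2 * B * w - C"
  define T where "T = C ^ 2 - B ^ 3 - 3 * B * C * w - C * w ^ 3"
  define r1 where "r1 = Z * U * Y - Z ^ 2 * p"
  define r2 where "r2 = Z ^ 2 * V * Y - Z ^ 3 * B * U"
  have conv [simp]: "A \<in> convergent_series" "B \<in> convergent_series" "C \<in> convergent_series"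
    "w \<in> convergent_series" "U \<in> convergent_series" "p \<in> convergent_series" "V \<in> convergent_series"
    by (simp_all add: A_def B_def C_def w_def U_def p_def V_def)
  have "(-1) * ?g + (- w) * ?f \<in> I"
    by (intro add_mem mult_mem f g) simp_all
  also have "(-1) * ?g + (- w) * ?f = r1"
    by (simp add: r1_def U_def p_def w_def A_def B_def C_def algebra_simps eval_nat_numeral)
  finally have r1: "r1 \<in> I" .
  \<comment> \<open>\<open>- r1\<close> and \<open>r2\<close> are the remainders of \<open>g\<close> and \<open>y g\<close> on division by \<open>f\<close> in \<open>y\<close>.\<close>
  have "(- Y) * r1 + (- Z * U) * ?f \<in> I"
    by (intro add_mem mult_mem r1 f) simp_all
  also have "(- Y) * r1 + (- Z * U) * ?f = r2"
    by (simp add: r1_def r2_def U_def p_def V_def w_def A_def B_def C_def algebra_simps eval_nat_numeral)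
  finally have r2: "r2 \<in> I" .
  \<comment> \<open>The leading coefficients \<open>Z * U\<close> and \<open>Z ^ 2 * V\<close> share
    a factor \<open>Z\<close>. Leaving it out of the elimination gives \<open>Z ^ 3 * T\<close>, one
    power of \<open>Z\<close> below the determinant.\<close>
  have "U * r2 - (Z * V) * r1 \<in> I"
    by (intro diff_mem mult_mem r1 r2) simp_all
  also have "U * r2 - (Z * V) * r1 = Z ^ 3 * T"
    by (simp add: r1_def r2_def T_def U_def p_def V_def algebra_simps eval_nat_numeral)
  finally have T: "Z ^ 3 * T \<in> I" .
  have coeff0: "coeff2 0 0 A = a" "coeff2 0 0 B = b" "coeff2 0 0 C = c" "coeff2 0 0 Z = 0" "coeff2 0 0 Y = 0"
    by (simp_all add: A_def B_def C_def coeff2_const coeff2_Z coeff2_Y)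
  show ?thesis
  proof (cases "a ^ 2 + b = 0")
    \<comment> \<open>Here \<open>U\<close> is a unit. The linear coefficient of \<open>T\<close> in
      \<open>Z\<close> is \<open>- 3 * c * (a ^ 2 + b)\<close>, also nonzero, so \<open>T\<close>
      vanishes to order at most one and \<open>Z ^ 3 * T\<close> yields
      \<open>Z ^ 4\<close>.\<close>
    case False
    then have U0: "coeff2 0 0 U \<noteq> 0"
      by (simp add: U_def w_def coeff0 coeff2_0_mult power2_eq_square)
    define t0 where "t0 = c ^ 2 - b ^ 3 + 3 * a * b * c + c * a ^ 3"
    define t where "t = const_germ (- 3 * c * (a ^ 2 + b)) + 3 * A * C * Z - C * Z ^ 2"
    have T_expand: "T = const_germ t0 + Z * t"
      by (simp add: T_def t_def t0_def w_def A_def B_def C_def const_germ_hom algebra_simps eval_nat_numeral)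
    have z4: "Z ^ 4 \<in> I"
    proof (cases "t0 = 0")
      case True
      have "t * Z ^ 4 \<in> I"
        using T by (simp add: T_expand True const_germ_hom algebra_simps eval_nat_numeral)
      moreover have "coeff2 0 0 t \<noteq> 0"
        using False c by (simp add: t_def coeff0 coeff2_const coeff2_0_mult power2_eq_square)
      ultimately show ?thesis by (rule unit_mult_mem) (simp add: t_def)
    next
      case False
      then have "coeff2 0 0 T \<noteq> 0"
        by (simp add: T_expand coeff0 coeff2_const)
      moreover have "T \<in> convergent_series" by (simp add: T_def)
      moreover have "T * Z ^ 4 \<in> I"
        using mult_mem[OF T, of Z] by (simp add: algebra_simps eval_nat_numeral)
      ultimately show ?thesis using unit_mult_mem by blast
    qed
    have "Z ^ 2 * r1 + p * Z ^ 4 \<in> I"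
      by (intro add_mem mult_mem r1 z4) simp_all
    also have "Z ^ 2 * r1 + p * Z ^ 4 = U * (Y * Z ^ 3)"
      by (simp add: r1_def algebra_simps eval_nat_numeral)
    finally have yz3: "Y * Z ^ 3 \<in> I"
      by (rule unit_mult_mem) (use U0 in simp_all)
    define u where "u = inverse (a ^ 2 + b)"
    have u: "const_germ u * (A ^ 2 + B) = 1"
      using False by (simp add: A_def B_def u_def flip: const_germ_hom)
    \<comment> \<open>Expanding \<open>U\<close> and \<open>p\<close> in powers of \<open>Z\<close>,
      only their constant terms \<open>A ^ 2 + B\<close> and \<open>- (A * B + C)\<close> survive in
      \<open>Z * r1\<close> modulo \<open>Y * Z ^ 3\<close> and \<open>Z ^ 4\<close>.\<close>
    have "const_germ u * (Z * r1 - (Z - 2 * A) * (Y * Z ^ 3) + B * Z ^ 4) \<in> I"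
      by (intro add_mem diff_mem mult_mem r1 z4 yz3) simp_all
    also have "Z * r1 - (Z - 2 * A) * (Y * Z ^ 3) + B * Z ^ 4
        = (A ^ 2 + B) * (Y * Z ^ 2) + (A * B + C) * Z ^ 3"
      by (simp add: r1_def U_def p_def w_def algebra_simps eval_nat_numeral)
    also have "const_germ u * ((A ^ 2 + B) * (Y * Z ^ 2) + (A * B + C) * Z ^ 3)
        = (const_germ u * (A ^ 2 + B)) * (Y * Z ^ 2) - const_germ (- u * (a * b + c)) * Z ^ 3"
      by (simp add: A_def B_def C_def const_germ_hom algebra_simps)
    finally show ?thesis using that z4 by (simp add: u)
  next
    case True
    then have b: "b = - (a ^ 2)" by (simp add: eq_neg_iff_add_eq_0 add.commute)
    then have B: "B = - (A ^ 2)" by (simp add: A_def B_def const_germ_hom)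
    show ?thesis
    proof (cases "c = a ^ 3")
      case False
      \<comment> \<open>Now \<open>U = Z * (Z - 2 * A)\<close>, so \<open>r1\<close> is divisible by
        \<open>Z ^ 2\<close>, and the cofactor has constant term \<open>c - a ^ 3\<close>.\<close>
      have "((Z - 2 * A) * Y - B * Z + (A * B + C)) * Z ^ 2 \<in> I"
        using r1 by (simp add: r1_def U_def p_def w_def B algebra_simps eval_nat_numeral)
      then have z2: "Z ^ 2 \<in> I"
      proof (rule unit_mult_mem)
        show "coeff2 0 0 ((Z - 2 * A) * Y - B * Z + (A * B + C)) \<noteq> 0"
          using False by (simp add: coeff0 coeff2_0_mult b eval_nat_numeral)
      qed simp
      have "Z ^ 4 \<in> I" "Y * Z ^ 2 - const_germ 0 * Z ^ 3 \<in> I"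
        using mult_mem[OF z2, of "Z ^ 2"] mult_mem[OF z2, of Y]
        by (simp_all add: const_germ_hom eval_nat_numeral mult.assoc)
      then show ?thesis using that by blast
    next
      case True
      then have C: "C = A ^ 3" by (simp add: A_def C_def const_germ_hom)
      have a: "a \<noteq> 0" using True c by auto
      \<comment> \<open>Now \<open>T\<close> vanishes to order two, so \<open>Z ^ 3 * T\<close>
        would give only \<open>Z ^ 5\<close>. But \<open>V = Z * (Z ^ 2 - 3 * A * Z + A ^ 2)\<close>
        shares another factor \<open>Z\<close> with \<open>U\<close>, and cancelling it recovers
        \<open>Z ^ 4\<close>.\<close>
      have "((Z ^ 2 - 3 * A * Z + A ^ 2) * Z) * r1 - (Z - 2 * A) * r2 \<in> I"
        by (intro diff_mem mult_mem r1 r2) simp_all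
      also have "((Z ^ 2 - 3 * A * Z + A ^ 2) * Z) * r1 - (Z - 2 * A) * r2
          = (A ^ 3 * (Z - 3 * A)) * Z ^ 4"
        by (simp add: r1_def r2_def U_def p_def V_def w_def B C algebra_simps eval_nat_numeral)
      finally have z4: "Z ^ 4 \<in> I"
        by (rule unit_mult_mem) (use a in \<open>simp_all add: coeff0 coeff2_0_mult coeff2_0_numeral power3_eq_cube\<close>)
      have "Z * r1 - A ^ 2 * Z ^ 4 \<in> I"
        by (intro diff_mem mult_mem r1 z4) simp_all
      also have "Z * r1 - A ^ 2 * Z ^ 4 = (Z - 2 * A) * (Y * Z ^ 3)"
        by (simp add: r1_def U_def p_def w_def B C algebra_simps eval_nat_numeral)
      finally have yz3: "Y * Z ^ 3 \<in> I"
        by (rule unit_mult_mem) (use a in \<open>simp_all add: coeff0 coeff2_0_mult coeff2_0_numeral\<close>)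
      define h where "h = const_germ (inverse (2 * a))"
      have h: "h * (2 * A) = 1"
        using a by (simp add: h_def A_def flip: const_germ_hom)
      have "h * (Y * Z ^ 3 - r1) \<in> I"
        by (intro diff_mem mult_mem r1 yz3) (simp add: h_def)
      also have "h * (Y * Z ^ 3 - r1) = (h * (2 * A)) * (Y * Z ^ 2) - (h * A ^ 2) * Z ^ 3"
        by (simp add: r1_def U_def p_def w_def B C algebra_simps eval_nat_numeral)
      also have "h * A ^ 2 = const_germ (inverse (2 * a) * a ^ 2)"
        unfolding h_def A_def by (simp only: const_germ_hom)
      finally show ?thesis using that z4 by (simp add: h)
    qed
  qed
qed

end

section \<open>The ideal of two germs and the dimension of its quotient\<close>

lemma intersection_ideal_germ_ideal: "germ_ideal (intersection_ideal f g)"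
  unfolding intersection_ideal_def
  by (rule germ_ideal.intro, rule local_ring.genideal_ideal) (simp add: germ_in_convergent_series)

lemma germ_in_intersection_ideal:
  "germ f \<in> intersection_ideal f g" "germ g \<in> intersection_ideal f g"
  using local_ring.genideal_self[of "{germ f, germ g}"]
  by (simp_all add: intersection_ideal_def germ_in_convergent_series)

text \<open>The combinations with convergent multipliers already form an ideal containing both
  generators, so minimality of the generated ideal applies.\<close>

lemma intersection_idealE:
  assumes "x \<in> intersection_ideal f g"
  obtains u v where "x = u * germ f + v * germ g"
proof -
  define J where "J = {u * germ f + v * germ g | u v. u \<in> convergent_series \<and> v \<in> convergent_series}"
  have J: "u * germ f + v * germ g \<in> J" if "u \<in> convergent_series" "v \<in> convergent_series" for u v
    using that by (auto simp: J_def)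
  have "ideal J local_ring"
  proof (rule idealI)
    show "subgroup J (add_monoid local_ring)"
    proof (rule local_ring.add.subgroupI)
      show "J \<subseteq> carrier local_ring"
        by (auto simp: J_def germ_in_convergent_series)
      show "J \<noteq> {}" using J[of 0 0] by auto
    next
      fix a assume "a \<in> J"
      then obtain u v where uv: "u \<in> convergent_series" "v \<in> convergent_series"
        "a = u * germ f + v * germ g" by (auto simp: J_def)
      then have "\<ominus>\<^bsub>local_ring\<^esub> a = (- u) * germ f + (- v) * germ g"
        by (simp add: germ_in_convergent_series)
      then show "\<ominus>\<^bsub>local_ring\<^esub> a \<in> J" using J[of "- u" "- v"] uv by simp
      fix b assume "b \<in> J"
      then obtain u' v' where uv': "u' \<in> convergent_series" "v' \<in> convergent_series"
        "b = u' * germ f + v' * germ g" by (auto simp: J_def)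
      have "a + b = (u + u') * germ f + (v + v') * germ g"
        by (simp add: uv uv' algebra_simps)
      then show "a \<oplus>\<^bsub>local_ring\<^esub> b \<in> J"
        using J[of "u + u'" "v + v'"] uv uv' by simp
    qed
  next
    fix a x assume "a \<in> J" and x: "x \<in> carrier local_ring"
    then obtain u v where uv: "u \<in> convergent_series" "v \<in> convergent_series"
      "a = u * germ f + v * germ g" by (auto simp: J_def)
    have *: "x * a = (x * u) * germ f + (x * v) * germ g"
      by (simp add: uv algebra_simps)
    show "x \<otimes>\<^bsub>local_ring\<^esub> a \<in> J"
      using * J[of "x * u" "x * v"] uv x by simp
    then show "a \<otimes>\<^bsub>local_ring\<^esub> x \<in> J" by (simp add: mult.commute)
  qed (rule local_ring.ring_axioms)
  moreover have "{germ f, germ g} \<subseteq> J" using J[of 1 0] J[of 0 1] by simp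
  ultimately have "intersection_ideal f g \<subseteq> J"
    unfolding intersection_ideal_def by (rule local_ring.genideal_minimal)
  then show ?thesis using assms that by (auto simp: J_def)
qed

text \<open>Reduces both bounds to memberships in \<open>I\<close>, with no cosets left to handle.
  Properness makes the quotient nonzero, so that the image of the constants is still a
  field.\<close>

lemma intersection_index_bounds:
  fixes f g :: "complex poly poly" and Us Vs :: "complex fps fps list"
  defines "I \<equiv> intersection_ideal f g"
  assumes proper: "1 \<notin> I"
    and Us: "set Us \<subseteq> convergent_series"
    and spans: "\<And>x. x \<in> convergent_series \<Longrightarrow>
      \<exists>Ks. set Ks \<subseteq> range const_germ \<and> x - ring.combine local_ring Ks Us \<in> I"
    and Vs: "set Vs \<subseteq> convergent_series"
    and indep: "\<And>Ks. set Ks \<subseteq> range const_germ \<Longrightarrow> length Ks = length Vs \<Longrightarrow>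
      ring.combine local_ring Ks Vs \<in> I \<Longrightarrow> set Ks \<subseteq> {0}"
  shows "length Vs \<le> intersection_index f g \<and> intersection_index f g \<le> length Us"
proof -
  let ?h = "(+>\<^bsub>local_ring\<^esub>) I"
  define Q where "Q = local_ring Quot I"
  have ideal: "ideal I local_ring"
    using intersection_ideal_germ_ideal unfolding I_def germ_ideal_def .
  interpret \<pi>: ring_hom_ring local_ring Q ?h
    unfolding Q_def by (rule ideal.rcos_ring_hom_ring[OF ideal])
  have eq_iff: "?h x = ?h y \<longleftrightarrow> x - y \<in> I" if "x \<in> convergent_series" "y \<in> convergent_series" for x y
    using local_ring.quotient_eq_iff_same_a_r_cos[OF ideal, of x y] that by simp
  have zero_iff: "?h x = \<zero>\<^bsub>Q\<^esub> \<longleftrightarrow> x \<in> I" if "x \<in> convergent_series" for x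
    using eq_iff[OF that, of 0] \<pi>.hom_zero by simp
  have one: "\<one>\<^bsub>Q\<^esub> \<noteq> \<zero>\<^bsub>Q\<^esub>"
    using zero_iff[of 1] proper \<pi>.hom_one by simp
  have surj: "?h ` carrier local_ring = carrier Q"
    by (auto simp: Q_def FactRing_def A_RCOSETS_def')
  have scalars: "intersection_scalars f g = ?h ` range const_germ"
    by (auto simp: intersection_scalars_def I_def germ_cst)
  have combine: "local_ring.combine Ks Ws \<in> convergent_series"
    if "set Ks \<subseteq> range const_germ" "set Ws \<subseteq> convergent_series" for Ks Ws
  proof -
    have "set Ks \<subseteq> carrier local_ring" using that(1) by auto
    then show ?thesis using local_ring.combine_in_carrier[of Ks Ws] that(2) by simp
  qed
  have "\<exists>n\<le>length Us. \<pi>.dimension n (?h ` range const_germ) (carrier Q)"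
  proof (rule \<pi>.image_dimension_le[OF subfield_constants one surj])
    fix x assume "x \<in> carrier local_ring"
    then show "\<exists>Ks. set Ks \<subseteq> range const_germ \<and> ?h x = ?h (local_ring.combine Ks Us)"
      using spans[of x] eq_iff combine[OF _ Us] by auto
  qed (use Us in auto)
  then obtain n where n: "n \<le> length Us" "\<pi>.dimension n (?h ` range const_germ) (carrier Q)"
    by blast
  have "length Vs \<le> n"
  proof (rule \<pi>.image_dimension_ge[OF subfield_constants one _ _ n(2)])
    fix Ks assume "set Ks \<subseteq> range const_germ" "length Ks = length Vs"
      "?h (local_ring.combine Ks Vs) = \<zero>\<^bsub>Q\<^esub>"
    then show "set Ks \<subseteq> {\<zero>\<^bsub>local_ring\<^esub>}"
      using indep zero_iff[OF combine[OF _ Vs]] by simp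
  qed (use Vs in auto)
  moreover have "intersection_index f g = enat n"
    using \<pi>.dimI[OF \<pi>.img_is_subfield(2)[OF subfield_constants one] n(2)] \<pi>.finite_dimensionI[OF n(2)]
    by (simp add: intersection_index_def intersection_algebra_def scalars over_def Let_def
        flip: I_def Q_def)
  ultimately show ?thesis using n(1) by simp
qed

section \<open>Multiplicity at the point [1:0:0]\<close>

lemma coeff_hom_component:
  "coeff (coeff (hom_component d p) j) i = (if i + j = d then coeff (coeff p j) i else 0)"
proof -
  have "coeff (coeff (hom_component d p) j) i
      = (\<Sum>k\<le>d. if k = i then (if d - i = j then coeff (coeff p (d - i)) i else 0) else 0)"
    unfolding hom_component_def coeff_sum by (intro sum.cong) auto
  also have "\<dots> = (if i + j = d then coeff (coeff p j) i else 0)"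
    by (auto simp: sum.delta)
  finally show ?thesis .
qed

text \<open>Putting \<open>x = 1\<close> sums the homogeneous components of degree at most
  \<open>d\<close>; with \<open>d = 3\<close> the degrees zero and one, the only ones read off
  later, are intact.\<close>

lemma coeff_dehomogenize_homogenize:
  "coeff (coeff (poly (homogenize d p) 1) j) i = (if i + j \<le> d then coeff (coeff p j) i else 0)"
  by (simp add: homogenize_def poly_sum poly_monom coeff_sum coeff_hom_component)

lemma lowest_degree_gt_imp_coeff_eq_0:
  assumes "enat (i + j) < lowest_degree p"
  shows "coeff (coeff p j) i = 0"
proof (rule ccontr)
  assume "coeff (coeff p j) i \<noteq> 0"
  then have "hom_component (i + j) p \<noteq> 0"
    using coeff_hom_component[of "i + j" p j i] by auto
  then have "lowest_degree p \<le> enat (i + j)"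
    unfolding lowest_degree_def by (intro INF_lower) simp
  then show False using assms by simp
qed

theorem theorem5p5:
  fixes C12_10 C12_01 C21_10 C21_20 C21_01 C21_11 C21_02 :: complex
    and f g :: "complex poly poly"
    and A B C :: "complex poly poly poly"
  assumes C21_02_nonzero: "C21_02 \<noteq> 0"
    and f_eq: "f = - cst C12_10 * var_y - var_y ^ 2 - cst C12_01 * var_z
                 + cst C21_20 * var_y * var_z + cst C21_11 * var_z ^ 2 - var_y * var_z ^ 2"
    and g_eq: "g = - cst C21_10 * var_y - cst C21_20 * var_y ^ 2 - cst C21_01 * var_z
                 - cst C21_11 * var_y * var_z + var_y ^ 2 * var_z - cst C21_02 * var_z ^ 2"
    and B_eq: "B = homogenize 3 f"
    and C_eq: "C = homogenize 3 g"
    and form: "projective_one_form 3 (A, B, C)"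
    and mult_2: "alg_multiplicity_100 (A, B, C) = 2"
  shows "4 \<le> intersection_index f g \<and> intersection_index f g \<le> 6"
proof -
  define a b c where "a = C21_20" and "b = C21_11" and "c = C21_02"
  define I where "I = intersection_ideal f g"
  have germ_f: "germ f = - const_germ C12_10 * Y - Y ^ 2 - const_germ C12_01 * Z
      + const_germ a * Y * Z + const_germ b * Z ^ 2 - Y * Z ^ 2"
    by (simp add: f_eq germ_hom germ_cst germ_var_y germ_var_z a_def b_def)
  have germ_g: "germ g = - const_germ C21_10 * Y - const_germ a * Y ^ 2 - const_germ C21_01 * Z
      - const_germ b * Y * Z + Y ^ 2 * Z - const_germ c * Z ^ 2"
    by (simp add: g_eq germ_hom germ_cst germ_var_y germ_var_z a_def b_def c_def)
  note coeffs = power2_eq_square mult.assoc coeff2_Y coeff2_Z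

  have low: "coeff2 i j (germ f) = 0" "coeff2 i j (germ g) = 0" if "i + j < 2" for i j
  proof -
    have "enat (i + j) < 2" using that by (simp add: numeral_eq_enat)
    moreover have "2 \<le> lowest_degree (poly B 1)" "2 \<le> lowest_degree (poly C 1)"
      using mult_2 unfolding alg_multiplicity_100_def by (simp_all add: min_def split: if_splits)
    ultimately have "enat (i + j) < lowest_degree (poly B 1)" "enat (i + j) < lowest_degree (poly C 1)"
      by (auto intro: less_le_trans)
    then show "coeff2 i j (germ f) = 0" "coeff2 i j (germ g) = 0"
      using lowest_degree_gt_imp_coeff_eq_0 that
      by (auto simp: coeff2_germ B_eq C_eq coeff_dehomogenize_homogenize dest!: lowest_degree_gt_imp_coeff_eq_0)
  qed
  have lin: "C12_10 = 0" "C12_01 = 0" "C21_10 = 0" "C21_01 = 0"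
    using low[of 1 0] low[of 0 1] by (simp_all add: germ_f germ_g coeffs)
  have f: "germ f = - (Y ^ 2) + const_germ a * Y * Z + const_germ b * Z ^ 2 - Y * Z ^ 2"
    and g: "germ g = - const_germ a * Y ^ 2 - const_germ b * Y * Z - const_germ c * Z ^ 2 + Y ^ 2 * Z"
    by (simp_all add: germ_f germ_g lin const_germ_hom)

  interpret germ_ideal I
    unfolding I_def by (rule intersection_ideal_germ_ideal)
  have fI: "germ f \<in> I" and gI: "germ g \<in> I"
    unfolding I_def by (rule germ_in_intersection_ideal)+
  obtain \<kappa> where rel: "Z ^ 4 \<in> I" "Y * Z ^ 2 - const_germ \<kappa> * Z ^ 3 \<in> I"
    using standard_relations[OF C21_02_nonzero, of a b] fI gI unfolding f g c_def by blast
  have "Y ^ 2 - (const_germ a * Y * Z + const_germ b * Z ^ 2 - Y * Z ^ 2) \<in> I"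
    using diff_mem[OF zero_mem fI] by (simp add: f algebra_simps)
  note spanned = spanned_by_six[OF this rel]

  \<comment> \<open>Both germs start in degree two, so up to that degree only the constant terms of
    the multipliers contribute.\<close>
  have deg2: "coeff2 i j (u * germ f + v * germ g)
      = (if i + j < 2 then 0 else coeff2 0 0 u * coeff2 i j (germ f) + coeff2 0 0 v * coeff2 i j (germ g))"
    if "i + j \<le> 2" for i j u v
  proof -
    have "coeff2 i j (w * germ f) = coeff2 0 0 w * coeff2 i j (germ f)"
      "coeff2 i j (w * germ g) = coeff2 0 0 w * coeff2 i j (germ g)" for w
      using that low by (intro coeff2_mult_lowest; simp)+
    then show ?thesis using low[of i j] by auto
  qed
  \<comment> \<open>The parameters \<open>s\<close> and \<open>t\<close> are the constant terms of
    the multipliers of \<open>f\<close> and \<open>g\<close>.\<close>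
  have I_coeffs: "coeff2 0 0 x = 0 \<and> coeff2 1 0 x = 0 \<and> coeff2 0 1 x = 0 \<and>
      (\<exists>s t. coeff2 2 0 x = - s - a * t \<and> coeff2 1 1 x = a * s - b * t \<and> coeff2 0 2 x = b * s - c * t)"
    if "x \<in> I" for x
  proof -
    obtain u v where x: "x = u * germ f + v * germ g"
      using intersection_idealE \<open>x \<in> I\<close> unfolding I_def by blast
    have "coeff2 2 0 (germ f) = -1" "coeff2 1 1 (germ f) = a" "coeff2 0 2 (germ f) = b"
      "coeff2 2 0 (germ g) = - a" "coeff2 1 1 (germ g) = - b" "coeff2 0 2 (germ g) = - c"
      by (simp_all add: f g coeffs)
    then show ?thesis
      using deg2[of 0 0 u v] deg2[of 1 0 u v] deg2[of 0 1 u v]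
        deg2[of 2 0 u v] deg2[of 1 1 u v] deg2[of 0 2 u v]
      unfolding x by (intro conjI exI[of _ "coeff2 0 0 u"] exI[of _ "coeff2 0 0 v"]) simp_all
  qed

  \<comment> \<open>A combination of the two quadratic parts without \<open>Y ^ 2\<close> has
    \<open>s = - a * t\<close>, so its \<open>Y * Z\<close> coefficient is
    \<open>- (a ^ 2 + b) * t\<close>. If \<open>a ^ 2 + b\<close> is zero it cannot be a nonzero
    multiple of \<open>Y * Z\<close>; otherwise \<open>t = 0\<close> follows for a multiple of
    \<open>Z ^ 2\<close>.\<close>
  define q where "q = (if a ^ 2 + b = 0 then Y * Z else Z ^ 2)"
  have "length [1, Y, Z, q] \<le> intersection_index f g \<and>
    intersection_index f g \<le> length [1, Y, Z, Y * Z, Z ^ 2, Z ^ 3]"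
  proof (rule intersection_index_bounds)
    show "1 \<notin> intersection_ideal f g"
      using I_coeffs[of 1] unfolding I_def by (auto simp: coeff2_one)
  next
    fix x :: "complex fps fps" assume "x \<in> convergent_series"
    from spanned[OF this] obtain c1 c2 c3 c4 c5 c6 where
      "x - (const_germ c1 + const_germ c2 * Y + const_germ c3 * Z
           + const_germ c4 * (Y * Z) + const_germ c5 * Z ^ 2 + const_germ c6 * Z ^ 3) \<in> I" by blast
    then show "\<exists>Ks. set Ks \<subseteq> range const_germ \<and>
        x - local_ring.combine Ks [1, Y, Z, Y * Z, Z ^ 2, Z ^ 3] \<in> intersection_ideal f g"
      by (intro exI[of _ "map const_germ [c1, c2, c3, c4, c5, c6]"])
        (auto simp: I_def add.assoc)
  next
    fix Ks :: "complex fps fps list"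
    assume Ks: "set Ks \<subseteq> range const_germ" "length Ks = length [1, Y, Z, q]"
      and mem: "local_ring.combine Ks [1, Y, Z, q] \<in> intersection_ideal f g"
    obtain c1 c2 c3 c4 where Ks_eq: "Ks = map const_germ [c1, c2, c3, c4]"
      using Ks by (auto simp: length_Suc_conv numeral_eq_Suc)
    define x where "x = const_germ c1 + const_germ c2 * Y + const_germ c3 * Z + const_germ c4 * q"
    have "x \<in> I" using mem by (simp add: Ks_eq x_def I_def add.assoc)
    from I_coeffs[OF this] obtain s t where
      "coeff2 0 0 x = 0" "coeff2 1 0 x = 0" "coeff2 0 1 x = 0"
      and st: "coeff2 2 0 x = - s - a * t" "coeff2 1 1 x = a * s - b * t" "coeff2 0 2 x = b * s - c * t"
      by blast
    then have "c1 = 0" "c2 = 0" "c3 = 0"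
      by (auto simp: x_def q_def coeff2_const coeffs split: if_splits)
    moreover have "c4 = 0"
    proof (cases "a ^ 2 + b = 0")
      case True
      have s: "s = - a * t" "c4 = a * s - b * t"
        using st(1,2) True by (simp_all add: x_def q_def coeff2_const coeffs eq_diff_eq)
      have "c4 = - ((a ^ 2 + b) * t)"
        unfolding s by (simp add: algebra_simps power2_eq_square)
      then show ?thesis using True by simp
    next
      case False
      have s: "s = - a * t" "0 = a * s - b * t" "c4 = b * s - c * t"
        using st False by (simp_all add: x_def q_def coeff2_const coeffs eq_diff_eq)
      then have "(a ^ 2 + b) * t = 0" by (simp add: algebra_simps power2_eq_square)
      then show ?thesis using False s by simp
    qed
    ultimately show "set Ks \<subseteq> {0}" by (simp add: Ks_eq const_germ_hom)
  qed (simp_all add: q_def)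
  then show ?thesis by (simp add: numeral_eq_enat eval_nat_numeral)
qed

end
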